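(* Let $p$ be an odd prime, $k\in\mathbb{N}$, $p\nmid k+1$, and $b=p+1$. Then $2p\cdot 1(k+1)_b\in\mathbb{V}_{p+1}$.
   Context: Natural numbers ($\mathbb{N}$) are positive integers. Every natural number $n$ has a unique base $b$ representation ($b\ge 2$) $n=a_0+a_1b+\cdots+a_{L-1}b^{L-1}$ with $L\ge 1$, integers $0\le a_i<b$ and $a_{L-1}\ne 0$. The digit reversal of $n$ in base $b$ is $r_b(n)=a_{L-1}+a_{L-2}b+\cdots+a_0b^{L-1}$. The function $v$ on natural numbers: if $n=p_1^{\varepsilon_1}\cdots p_s^{\varepsilon_s}q_1\cdots q_t$ with $s,t\ge 0$, integers $\varepsilon_i\ge 2$ and distinct primes $p_1,\dots,p_s,q_1,\dots,q_t$, then $v(n)=\sum_{i=1}^s(p_i+\varepsilon_i)+\sum_{j=1}^t q_j$ (so $v(1)=0$). A natural number $n$ is a $v$-palindrome in base $b$ if (i) $b\nmid n$, (ii) $n\ne r_b(n)$, and (iii) $v(n)=v(r_b(n))$. The set of $v$-palindromes in base $b$ is denoted $\mathbb{V}_b$. The notation $1(m)_b$ (repeated concatenation of the digit $1$, $m\ge 1$) denotes the number whose base $b$ representation consists of $m$ digits all equal to $1$, i.e. $1(m)_b=1+b+\cdots+b^{m-1}$. The expression $2p\cdot 1(k+1)_b$ is the product of $2p$ and $1(k+1)_b$. *)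

theory Defs
  imports "HOL-Computational_Algebra.Primes"
begin

(* Digits are listed least significant first; the guard makes the function
   total, and only the case b >= 2, n > 0 is meaningful. *)
fun base_digits :: "nat \<Rightarrow> nat \<Rightarrow> nat list" where
  "base_digits b n =
     (if b < 2 \<or> n = 0 then [] else n mod b # base_digits b (n div b))"

declare base_digits.simps [simp del]

lemma base_digits_representation:
  assumes "b \<ge> 2"
  shows "horner_sum (\<lambda>d. d) b (base_digits b n) = n"
    and "\<forall>d\<in>set (base_digits b n). d < b"
    and "n > 0 \<Longrightarrow> base_digits b n \<noteq> [] \<and> last (base_digits b n) \<noteq> 0"
proof -
  have "horner_sum (\<lambda>d. d) b (base_digits b n) = n \<and> (\<forall>d\<in>set (base_digits b n). d < b)
      \<and> (n > 0 \<longrightarrow> base_digits b n \<noteq> [] \<and> last (base_digits b n) \<noteq> 0)"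
    using assms
  proof (induction b n rule: base_digits.induct)
    case (1 b n)
    show ?case
    proof (cases "n = 0")
      case True
      then show ?thesis by (simp add: base_digits.simps)
    next
      case False
      then have IH: "horner_sum (\<lambda>d. d) b (base_digits b (n div b)) = n div b"
        "\<forall>d\<in>set (base_digits b (n div b)). d < b"
        "n div b > 0 \<longrightarrow> base_digits b (n div b) \<noteq> [] \<and> last (base_digits b (n div b)) \<noteq> 0"
        using 1 by auto
      have eq: "base_digits b n = n mod b # base_digits b (n div b)"
        using False 1(2) by (subst base_digits.simps) simp
      show ?thesis
      proof (cases "n div b = 0")
        case True
        then have "base_digits b (n div b) = []" by (simp add: base_digits.simps)
        moreover have "n < b" using True 1(2) by (simp add: div_eq_0_iff)
        ultimately show ?thesis using eq False by simp
      next
        case ndiv: False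
        then show ?thesis using IH eq 1(2) by auto
      qed
    qed
  qed
  then show "horner_sum (\<lambda>d. d) b (base_digits b n) = n"
    and "\<forall>d\<in>set (base_digits b n). d < b"
    and "n > 0 \<Longrightarrow> base_digits b n \<noteq> [] \<and> last (base_digits b n) \<noteq> 0"
    by auto
qed

lemma base_digits_unique:
  assumes "b \<ge> 2" "\<forall>d\<in>set ds. d < b" "ds \<noteq> [] \<longrightarrow> last ds \<noteq> 0"
  shows "base_digits b (horner_sum (\<lambda>d. d) b ds) = ds"
  using assms(2,3)
proof (induction ds)
  case Nil
  then show ?case by (simp add: base_digits.simps)
next
  case (Cons d ds)
  let ?h = "horner_sum (\<lambda>d. d) b ds"
  have IH: "base_digits b ?h = ds"
    using Cons by (auto split: if_splits)
  have "d + b * ?h \<noteq> 0"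
  proof
    assume "d + b * ?h = 0"
    then have "d = 0" "?h = 0" using assms(1) by auto
    then have "ds = []" using IH by (simp add: base_digits.simps)
    then show False using Cons.prems(2) \<open>d = 0\<close> by simp
  qed
  moreover have "(d + b * ?h) mod b = d" "(d + b * ?h) div b = ?h"
    using Cons.prems(1) assms(1) by auto
  ultimately show ?case
    using IH assms(1) by (simp add: base_digits.simps[of b "d + b * ?h"])
qed

definition digit_reversal :: "nat \<Rightarrow> nat \<Rightarrow> nat" where
  "digit_reversal b n = horner_sum (\<lambda>d. d) b (rev (base_digits b n))"

definition v_sum :: "nat \<Rightarrow> nat" where
  "v_sum n = (\<Sum>p\<in>prime_factors n.
     if multiplicity p n \<ge> 2 then p + multiplicity p n else p)"

definition v_palindromes :: "nat \<Rightarrow> nat set" where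
  "v_palindromes b = {n. n > 0 \<and> \<not> b dvd n \<and> n \<noteq> digit_reversal b n
     \<and> v_sum n = v_sum (digit_reversal b n)}"

definition repunit :: "nat \<Rightarrow> nat \<Rightarrow> nat" where
  "repunit b m = (\<Sum>i<m. b ^ i)"

lemma base_digits_repunit:
  assumes "b \<ge> 2"
  shows "base_digits b (repunit b m) = replicate m 1"
proof -
  have "repunit b m = horner_sum (\<lambda>d. d) b (replicate m 1)"
    by (simp add: repunit_def horner_sum_eq_sum atLeast0LessThan)
  then show ?thesis
    using assms base_digits_unique[of b "replicate m 1"] by (simp add: last_replicate)
qed

end

theory Submission
  imports Defs
begin

text \<open>
  Write \<open>R\<close> for the repunit with \<open>k + 1\<close> digits in base \<open>b = p + 1\<close>. Since \<open>2 * p = (p - 1) + b\<close>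
  has the digits \<open>p - 1, 1\<close> (least significant first), multiplying it by \<open>R\<close> adds \<open>k + 1\<close> shifted
  copies of these two digits. Overlapping digits sum to \<open>p = b - 1\<close>, so nothing is carried: the
  digits of \<open>2 * p * R\<close> are \<open>p - 1\<close>, then \<open>k\<close> times \<open>p\<close>, then \<open>1\<close>. Reversing them gives \<open>R\<close> times
  the reversal \<open>1 + (p - 1) * b\<close> of \<open>2 * p\<close>, which is \<open>p\<^sup>2\<close>; this is
  \<open>digit_reversal_two_prime_repunit\<close>.

  So the numbers to compare are \<open>2 * p * R\<close> and \<open>p\<^sup>2 * R\<close>. The repunit \<open>R\<close> is odd, because \<open>b\<close> is
  even, and prime to \<open>p\<close>, because \<open>b\<close> is \<open>1\<close> modulo \<open>p\<close> and hence \<open>R\<close> is \<open>k + 1\<close>. As \<open>v_sum\<close> is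
  additive on coprime factors, \<open>R\<close> contributes equally to both sides, and what remains is
  \<open>v_sum (2 * p) = 2 + p = v_sum (p\<^sup>2)\<close>: the prime \<open>2\<close> on one side balances the exponent \<open>2\<close> on the
  other. The two numbers differ since \<open>2 \<noteq> p\<close>, and \<open>b\<close> does not divide the first one since its last
  digit is \<open>p - 1 > 0\<close>.
\<close>

text \<open>
  The prime factors of a coprime product split into two disjoint sets, and a prime keeps its
  multiplicity because it does not divide the other factor.
\<close>

lemma v_sum_mult_coprime:
  assumes "coprime m n" "m > 0" "n > 0"
  shows "v_sum (m * n) = v_sum m + v_sum n"
proof -
  let ?f = "\<lambda>x p::nat. if multiplicity p x \<ge> 2 then p + multiplicity p x else p"
  have split: "prime_factors (m * n) = prime_factors m \<union> prime_factors n"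
    using assms by (simp add: prime_factors_product)
  have not_both: "\<not> (p dvd m \<and> p dvd n)" if "prime p" for p
    using coprime_common_divisor[OF assms(1), of p] that by auto
  then have disjoint: "prime_factors m \<inter> prime_factors n = {}"
    by (auto simp: in_prime_factors_iff)
  have mult: "multiplicity p (m * n) = multiplicity p m + multiplicity p n" if "prime p" for p
    using assms that by (simp add: prime_elem_multiplicity_mult_distrib)
  have left: "?f (m * n) p = ?f m p" if "p \<in> prime_factors m" for p
    using that not_both[of p] mult[of p] not_dvd_imp_multiplicity_0[of p n]
    by (simp add: in_prime_factors_iff)
  have right: "?f (m * n) p = ?f n p" if "p \<in> prime_factors n" for p
    using that not_both[of p] mult[of p] not_dvd_imp_multiplicity_0[of p m]
    by (auto simp: in_prime_factors_iff)
  have "v_sum (m * n) = sum (?f (m * n)) (prime_factors m) + sum (?f (m * n)) (prime_factors n)"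
    unfolding v_sum_def split using disjoint by (intro sum.union_disjoint) auto
  also have "\<dots> = v_sum m + v_sum n"
    unfolding v_sum_def using left right by (intro arg_cong2[where f = "(+)"] sum.cong) auto
  finally show ?thesis .
qed

lemma v_sum_prime: "prime p \<Longrightarrow> v_sum p = p"
  by (simp add: v_sum_def prime_prime_factors)

lemma v_sum_prime_power:
  assumes "prime p" "e \<ge> 2"
  shows "v_sum (p ^ e) = p + e"
  using assms by (simp add: v_sum_def prime_factorization_prime_power)

text \<open>
  A geometric sum, stated additively because truncated subtraction on the natural numbers
  obstructs its use in ring calculations.
\<close>

lemma mult_repunit_plus_1: "p * repunit (p + 1) m + 1 = (p + 1) ^ m"
  by (induction m) (simp_all add: repunit_def algebra_simps)

lemma horner_sum_replicate:
  "horner_sum (\<lambda>d. d) b (replicate m d) = d * repunit b m"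
  by (simp add: repunit_def horner_sum_eq_sum atLeast0LessThan sum_distrib_left)

lemma repunit_mod_pred: "repunit (p + 1) m mod p = m mod p"
proof -
  have "(p + 1) ^ i mod p = 1 mod p" for i
    using power_mod[of "p + 1" p i] power_mod[of 1 p i] by (metis mod_add_self1 power_one)
  then have "(\<Sum>i<m. (p + 1) ^ i) mod p = (\<Sum>i<m. 1) mod p"
    using mod_sum_eq[of "\<lambda>i. (p + 1) ^ i" p "{..<m}"] mod_sum_eq[of "\<lambda>i. 1" p "{..<m}"] by simp
  then show ?thesis
    by (simp add: repunit_def)
qed

text \<open>
  For even \<open>b\<close> this makes the repunit odd; in general it allows cancelling the repunit when
  divisibility of a multiple by \<open>b\<close> is in question.
\<close>

lemma coprime_base_repunit:
  assumes "m > 0"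
  shows "coprime b (repunit b m)"
proof -
  obtain l where "m = Suc l"
    using assms gr0_implies_Suc by blast
  then have "repunit b m = 1 + b * repunit b l"
    unfolding repunit_def by (simp add: sum.lessThan_Suc_shift sum_distrib_left del: sum.lessThan_Suc)
  then have "d dvd 1" if "d dvd b" "d dvd repunit b m" for d
    using that by (metis dvd_add_left_iff dvd_mult2)
  then show ?thesis
    by (intro coprimeI)
qed

text \<open>
  In both digit lists the middle block is worth \<open>p * repunit (p + 1) k = (p + 1) ^ k - 1\<close>, so the
  values telescope to \<open>2 * ((p + 1) ^ (k + 1) - 1)\<close> and \<open>p * ((p + 1) ^ (k + 1) - 1)\<close>.
\<close>

lemma digit_reversal_two_prime_repunit:
  assumes "p \<ge> 1"
  shows "digit_reversal (p + 1) (2 * p * repunit (p + 1) (k + 1))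
    = p\<^sup>2 * repunit (p + 1) (k + 1)"
proof -
  obtain q where q: "p = q + 1"
    using le_Suc_ex[OF assms] by auto
  let ?b = "p + 1"
  define ds where "ds = q # replicate k p @ [1]"
  have block: "p * repunit ?b k + 1 = ?b ^ k"
    and whole: "p * repunit ?b (k + 1) + 1 = ?b * ?b ^ k"
    using mult_repunit_plus_1[of p k] mult_repunit_plus_1[of p "k + 1"] by simp_all
  have "horner_sum (\<lambda>d. d) ?b ds = q + ?b * (p * repunit ?b k + ?b ^ k)"
    by (simp add: ds_def horner_sum_append horner_sum_replicate)
  also have "\<dots> + 2 = 2 * (?b * ?b ^ k)"
    unfolding block[symmetric] by (simp add: q algebra_simps)
  also have "\<dots> = 2 * p * repunit ?b (k + 1) + 2"
    unfolding whole[symmetric] by simp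
  finally have digits_sum: "horner_sum (\<lambda>d. d) ?b ds = 2 * p * repunit ?b (k + 1)"
    by simp
  have "horner_sum (\<lambda>d. d) ?b (rev ds) = 1 + ?b * (p * repunit ?b k + ?b ^ k * q)"
    by (simp add: ds_def horner_sum_append horner_sum_replicate)
  also have "\<dots> + p = p * (?b * ?b ^ k)"
    unfolding block[symmetric] by (simp add: q algebra_simps)
  also have "\<dots> = p\<^sup>2 * repunit ?b (k + 1) + p"
    unfolding whole[symmetric] by (simp add: power2_eq_square algebra_simps)
  finally have reversed: "horner_sum (\<lambda>d. d) ?b (rev ds) = p\<^sup>2 * repunit ?b (k + 1)"
    by simp
  have "base_digits ?b (horner_sum (\<lambda>d. d) ?b ds) = ds"
    using assms by (intro base_digits_unique) (auto simp: ds_def q)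
  then show ?thesis
    by (simp only: digit_reversal_def digits_sum[symmetric] reversed)
qed

theorem theorem11:
  fixes p k b :: nat
  assumes "prime p" and "odd p"
    and "k \<ge> 1"
    and "\<not> p dvd (k + 1)"
    and "b = p + 1"
  shows "2 * p * repunit b (k + 1) \<in> v_palindromes (p + 1)"
proof -
  let ?R = "repunit b (k + 1)"
  have p3: "p \<ge> 3"
    using assms(1,2) prime_ge_2_nat[of p] by (cases "p = 2") auto
  have coprime_b: "coprime b ?R"
    by (rule coprime_base_repunit) simp
  have Rpos: "?R > 0"
    using coprime_b p3 assms(5) by (intro gr0I) auto
  have coprime_p: "coprime p ?R"
    using repunit_mod_pred[of p "k + 1"] assms(1,4,5)
    by (intro prime_imp_coprime) (auto simp: dvd_eq_mod_eq_0)
  have "2 dvd b"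
    using assms(2,5) by simp
  then have coprime_2: "coprime 2 ?R"
    using coprime_divisors[OF _ dvd_refl coprime_b] by blast
  have coprime_2p: "coprime 2 p"
    using assms(2) by simp
  have reversal: "digit_reversal b (2 * p * ?R) = p\<^sup>2 * ?R"
    using digit_reversal_two_prime_repunit[of p k] p3 assms(5) by simp
  have "v_sum (2 * p * ?R) = v_sum 2 + v_sum p + v_sum ?R"
    using v_sum_mult_coprime[of "2 * p" ?R] v_sum_mult_coprime[of 2 p]
      coprime_2 coprime_p coprime_2p Rpos p3 by simp
  also have "\<dots> = v_sum (p\<^sup>2) + v_sum ?R"
    using assms(1) by (simp add: v_sum_prime v_sum_prime_power)
  also have "\<dots> = v_sum (p\<^sup>2 * ?R)"
    using v_sum_mult_coprime[of "p\<^sup>2" ?R] coprime_p Rpos p3 by simp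
  finally have v_eq: "v_sum (2 * p * ?R) = v_sum (p\<^sup>2 * ?R)" .
  have "\<not> b dvd 2 * p * ?R"
  proof
    assume "b dvd 2 * p * ?R"
    then have "b dvd 2 * p"
      using coprime_b by (simp add: coprime_dvd_mult_left_iff)
    moreover have "2 * p = b + (p - 1)"
      using p3 assms(5) by simp
    ultimately have "b dvd p - 1"
      by (simp add: dvd_add_right_iff)
    then show False
      using p3 assms(5) by (auto dest: dvd_imp_le)
  qed
  moreover have "2 * p * ?R \<noteq> p\<^sup>2 * ?R"
    using Rpos p3 by (simp add: power2_eq_square)
  moreover have "2 * p * ?R > 0"
    using Rpos p3 by simp
  ultimately show ?thesis
    using v_eq reversal assms(5) by (simp add: v_palindromes_def)
qed

end
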